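(* Let $D\subsetneq\mathbb{R}^n$ be an open set with $\partial D\neq\emptyset$ and let $q\ge 1$. For any $x\in D$ and $r\in(0,1)$, $$B_{b_{D,q}}(x,R_1)\subset B_{\tilde c}(x,r)\subset B_{b_{D,q}}(x,R_2),$$ where $R_1=\frac{r}{2^{1/q}(1+r)}$ and $R_2=\frac{r}{2^{1/q}(1-r)}$. Moreover, $R_2/R_1\to 1$ as $r\to 0$.
   Context: For $x,y\in D$: $\tilde c_D(x,y)=\sup_{p\in\partial D}\frac{|x-y|}{\max\{|x-p|,|y-p|\}}$, and the Barrlund metric is $b_{D,q}(x,y)=\sup_{p\in\partial D}\frac{|x-y|}{(|x-p|^q+|y-p|^q)^{1/q}}$ for $q\ge1$. $\partial D$ is the boundary in $\mathbb{R}^n$. Metric balls: $B_{\tilde c}(x,r)=\{y\in D:\tilde c_D(x,y)<r\}$ and $B_{b_{D,q}}(x,R)=\{y\in D: b_{D,q}(x,y)<R\}$. *)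

theory Defs
  imports "HOL-Analysis.Analysis"
begin

text \<open>
  The suprema are taken in the reals. This is unproblematic for open \<open>D\<close> with nonempty
  frontier and \<open>x, y \<in> D\<close>: the family is nonempty, and since \<open>x\<close> has positive distance
  from the frontier, all denominators are positive and bounded away from 0.
\<close>

definition c_tilde :: "(real ^ 'n) set \<Rightarrow> real ^ 'n \<Rightarrow> real ^ 'n \<Rightarrow> real" where
  "c_tilde D x y = (SUP p\<in>frontier D. norm (x - y) / max (norm (x - p)) (norm (y - p)))"

definition barrlund :: "(real ^ 'n) set \<Rightarrow> real \<Rightarrow> real ^ 'n \<Rightarrow> real ^ 'n \<Rightarrow> real" where
  "barrlund D q x y =
    (SUP p\<in>frontier D.
      norm (x - y) / (norm (x - p) powr q + norm (y - p) powr q) powr (1 / q))"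

definition c_tilde_ball :: "(real ^ 'n) set \<Rightarrow> real ^ 'n \<Rightarrow> real \<Rightarrow> (real ^ 'n) set" where
  "c_tilde_ball D x r = {y \<in> D. c_tilde D x y < r}"

definition barrlund_ball :: "(real ^ 'n) set \<Rightarrow> real \<Rightarrow> real ^ 'n \<Rightarrow> real \<Rightarrow> (real ^ 'n) set" where
  "barrlund_ball D q x R = {y \<in> D. barrlund D q x y < R}"

definition R1 :: "real \<Rightarrow> real \<Rightarrow> real" where
  "R1 q r = r / (2 powr (1 / q) * (1 + r))"

definition R2 :: "real \<Rightarrow> real \<Rightarrow> real" where
  "R2 q r = r / (2 powr (1 / q) * (1 - r))"

end

theory Submission
  imports Defs
begin

text \<open>
  For \<open>p\<close> in the frontier let \<open>M\<close> and \<open>m\<close> be the larger and the smaller of \<open>|x - p|\<close>, \<open>|y - p|\<close>.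
  The \<open>q\<close>-norm of the pair lies between \<open>2\<^bsup>1/q\<^esup> m\<close> and \<open>2\<^bsup>1/q\<^esup> M\<close>. The upper bound gives
  \<open>c \<le> 2\<^bsup>1/q\<^esup> b\<close> for the two metrics. By the triangle inequality \<open>m \<ge> M - |x - y| \<ge> (1 - c) M\<close>,
  so the lower bound gives \<open>2\<^bsup>1/q\<^esup> b \<le> c / (1 - c)\<close> when \<open>c < 1\<close>.
\<close>

text \<open>On nonnegative reals \<open>powr q\<close> is strictly increasing and undoes
  \<open>powr (1 / q)\<close>, so applying it to both sides preserves and reflects the
  inequality.\<close>

lemma powr_inverse_le_iff:
  fixes a s q :: real
  assumes "0 \<le> a" "0 \<le> s" "0 < q"
  shows "a \<le> s powr (1 / q) \<longleftrightarrow> a powr q \<le> s"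
proof -
  have "(s powr (1 / q)) powr q = s"
    using assms by (simp add: powr_powr)
  then show ?thesis
    using assms by (metis powr_ge_zero powr_mono2 powr_less_mono2 not_less less_imp_le)
qed

text \<open>This keeps the Barrlund denominators positive and makes each Barrlund quotient at most
  the corresponding quotient of \<open>c_tilde\<close>.\<close>

lemma max_le_qnorm:
  fixes a b q :: real
  assumes "0 \<le> a" "0 \<le> b" "0 < q"
  shows "max a b \<le> (a powr q + b powr q) powr (1 / q)"
  using assms by (simp add: powr_inverse_le_iff)

lemma qnorm_le_max:
  fixes a b q :: real
  assumes "0 \<le> a" "0 \<le> b" "0 < q"
  shows "(a powr q + b powr q) powr (1 / q) \<le> 2 powr (1 / q) * max a b"
proof -
  have "a powr q + b powr q \<le> max a b powr q + max a b powr q"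
    using assms by (intro add_mono powr_mono2) auto
  also have "\<dots> = 2 * max a b powr q"
    by simp
  finally have "(a powr q + b powr q) powr (1 / q) \<le> (2 * max a b powr q) powr (1 / q)"
    using assms by (intro powr_mono2) auto
  then show ?thesis
    using assms by (simp add: powr_mult powr_powr le_max_iff_disj)
qed

lemma min_le_qnorm:
  fixes a b q :: real
  assumes "0 \<le> a" "0 \<le> b" "0 < q"
  shows "2 powr (1 / q) * min a b \<le> (a powr q + b powr q) powr (1 / q)"
proof -
  have "2 * min a b powr q = min a b powr q + min a b powr q"
    by simp
  also have "\<dots> \<le> a powr q + b powr q"
    using assms by (intro add_mono powr_mono2) auto
  finally have "(2 * min a b powr q) powr (1 / q) \<le> (a powr q + b powr q) powr (1 / q)"
    using assms by (intro powr_mono2) auto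
  then show ?thesis
    using assms by (simp add: powr_mult powr_powr)
qed

lemma open_frontier_dist_pos:
  fixes x p :: "'a::real_normed_vector"
  assumes "open D" "x \<in> D" "p \<in> frontier D"
  shows "0 < norm (x - p)"
  using assms by (auto simp: frontier_def interior_open)

text \<open>A ball of radius \<open>e\<close> around \<open>x\<close> inside \<open>D\<close> misses
  the frontier, so every denominator is at least \<open>e\<close>. Boundedness is what allows a
  single quotient to be compared with the real supremum.\<close>

lemma bdd_above_c_tilde:
  fixes D :: "(real ^ 'n) set"
  assumes "open D" "x \<in> D"
  shows "bdd_above ((\<lambda>p. norm (x - y) / max (norm (x - p)) (norm (y - p))) ` frontier D)"
proof -
  obtain e where e: "0 < e" "ball x e \<subseteq> D"
    using assms open_contains_ball by blast
  have "norm (x - y) / max (norm (x - p)) (norm (y - p)) \<le> norm (x - y) / e"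
    if "p \<in> frontier D" for p
  proof -
    have "p \<notin> ball x e"
      using that e assms by (auto simp: frontier_def interior_open)
    then have "e \<le> max (norm (x - p)) (norm (y - p))"
      by (simp add: dist_norm)
    then show ?thesis
      using e by (intro divide_left_mono mult_pos_pos) auto
  qed
  then show ?thesis
    by (intro bdd_aboveI2)
qed

lemma bdd_above_barrlund:
  fixes D :: "(real ^ 'n) set"
  assumes "open D" "x \<in> D" "0 < q"
  shows "bdd_above ((\<lambda>p. norm (x - y) / (norm (x - p) powr q + norm (y - p) powr q) powr (1 / q))
           ` frontier D)"
proof (rule bdd_aboveI2)
  fix p assume p: "p \<in> frontier D"
  have pos: "0 < max (norm (x - p)) (norm (y - p))"
    using open_frontier_dist_pos[OF assms(1,2) p] by (rule less_le_trans) simp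
  have le: "max (norm (x - p)) (norm (y - p)) \<le> (norm (x - p) powr q + norm (y - p) powr q) powr (1 / q)"
    using assms by (intro max_le_qnorm) auto
  have "norm (x - y) / (norm (x - p) powr q + norm (y - p) powr q) powr (1 / q)
      \<le> norm (x - y) / max (norm (x - p)) (norm (y - p))"
    using pos le by (intro divide_left_mono mult_pos_pos) auto
  also have "\<dots> \<le> c_tilde D x y"
    unfolding c_tilde_def using p bdd_above_c_tilde[OF assms(1,2)] by (rule cSUP_upper)
  finally show "norm (x - y) / (norm (x - p) powr q + norm (y - p) powr q) powr (1 / q)
      \<le> c_tilde D x y" .
qed

lemma c_tilde_le_barrlund:
  fixes D :: "(real ^ 'n) set"
  assumes "open D" "frontier D \<noteq> {}" "x \<in> D" "0 < q"
  shows "c_tilde D x y \<le> 2 powr (1 / q) * barrlund D q x y"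
  unfolding c_tilde_def
proof (rule cSUP_least[OF assms(2)])
  fix p assume p: "p \<in> frontier D"
  let ?M = "max (norm (x - p)) (norm (y - p))"
  let ?N = "(norm (x - p) powr q + norm (y - p) powr q) powr (1 / q)"
  have pos: "0 < ?M"
    using open_frontier_dist_pos[OF assms(1,3) p] by (rule less_le_trans) simp
  have N: "?M \<le> ?N" "?N \<le> 2 powr (1 / q) * ?M"
    using assms by (intro max_le_qnorm qnorm_le_max; simp)+
  have "norm (x - y) / ?M = 2 powr (1 / q) * (norm (x - y) / (2 powr (1 / q) * ?M))"
    by simp
  \<comment> \<open>The upper bound on \<open>?N\<close> gives the inequality; the lower bound makes
    \<open>?N\<close> positive.\<close>
  also have "\<dots> \<le> 2 powr (1 / q) * (norm (x - y) / ?N)"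
    using pos N by (intro mult_left_mono divide_left_mono mult_pos_pos) auto
  also have "norm (x - y) / ?N \<le> barrlund D q x y"
    unfolding barrlund_def using p bdd_above_barrlund[OF assms(1,3,4)] by (rule cSUP_upper)
  finally show "norm (x - y) / ?M \<le> 2 powr (1 / q) * barrlund D q x y"
    by simp
qed

lemma barrlund_le_c_tilde:
  fixes D :: "(real ^ 'n) set"
  assumes "open D" "frontier D \<noteq> {}" "x \<in> D" "0 < q" and c: "c_tilde D x y < 1"
  shows "barrlund D q x y \<le> R2 q (c_tilde D x y)"
  unfolding barrlund_def
proof (rule cSUP_least[OF assms(2)])
  fix p assume p: "p \<in> frontier D"
  define c where "c = c_tilde D x y"
  let ?M = "max (norm (x - p)) (norm (y - p))"
  let ?m = "min (norm (x - p)) (norm (y - p))"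
  let ?N = "(norm (x - p) powr q + norm (y - p) powr q) powr (1 / q)"
  have pos: "0 < ?M"
    using open_frontier_dist_pos[OF assms(1,3) p] by (rule less_le_trans) simp
  have "norm (x - y) / ?M \<le> c"
    unfolding c_def c_tilde_def using p bdd_above_c_tilde[OF assms(1,3)] by (rule cSUP_upper)
  then have d: "norm (x - y) \<le> c * ?M"
    using pos by (simp only: pos_divide_le_eq)
  \<comment> \<open>Since \<open>(x - p) - (y - p) = x - y\<close>, the reverse triangle inequality
    bounds \<open>?M - ?m\<close>.\<close>
  have "?M - norm (x - y) \<le> ?m"
    using norm_triangle_ineq3[of "x - p" "y - p"] by (auto simp: min_def max_def)
  with d have "(1 - c) * ?M \<le> ?m"
    by (simp add: left_diff_distrib)
  then have "2 powr (1 / q) * ((1 - c) * ?M) \<le> 2 powr (1 / q) * ?m"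
    by (rule mult_left_mono) simp
  also have "\<dots> \<le> ?N"
    using assms by (intro min_le_qnorm) auto
  finally have N: "2 powr (1 / q) * ((1 - c) * ?M) \<le> ?N" .
  \<comment> \<open>Here \<open>c < 1\<close> enters: the lower bound for \<open>?N\<close> is
    positive and can serve as a denominator.\<close>
  have pos': "0 < 2 powr (1 / q) * ((1 - c) * ?M)"
    using pos c by (intro mult_pos_pos) (auto simp: c_def)
  have "norm (x - y) / ?N \<le> (c * ?M) / (2 powr (1 / q) * ((1 - c) * ?M))"
    using d N pos' by (intro frac_le order_trans[OF norm_ge_zero d]) auto
  also have "\<dots> = R2 q c"
    using pos unfolding R2_def by (simp only: mult.assoc[symmetric] mult_divide_mult_cancel_right)
  finally show "norm (x - y) / ?N \<le> R2 q (c_tilde D x y)"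
    by (simp add: c_def)
qed

text \<open>For \<open>c < 1\<close>, \<open>c / (1 - c) = 1 / (1 - c) - 1\<close> increases with
  \<open>c\<close>. This turns the bound \<open>R2 q (c_tilde D x y)\<close> into the radius
  \<open>R2 q r\<close>.\<close>

lemma R2_strict_mono:
  assumes "c < r" "r < 1"
  shows "R2 q c < R2 q r"
proof -
  have "c / (1 - c) < r / (1 - r)"
    using assms by (simp add: field_simps)
  then have "c / (1 - c) / 2 powr (1 / q) < r / (1 - r) / 2 powr (1 / q)"
    by (rule divide_strict_right_mono) simp
  then show ?thesis
    by (simp add: R2_def mult.commute)
qed

lemma R1_scaled_less:
  assumes "0 < r"
  shows "2 powr (1 / q) * R1 q r < r"
proof -
  have "2 powr (1 / q) * R1 q r = r / (1 + r)"
    by (simp add: R1_def)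
  also have "\<dots> < r"
    using assms by (simp add: field_simps)
  finally show ?thesis .
qed

text \<open>The factors \<open>r\<close> and \<open>2 powr (1 / q)\<close> cancel. At
  \<open>r = 1\<close> both sides are 0, the value of division by zero.\<close>

lemma R2_div_R1:
  assumes "0 < r"
  shows "R2 q r / R1 q r = (1 + r) / (1 - r)"
  using assms by (simp add: R1_def R2_def)

theorem theorem2:
  fixes D :: "(real ^ 'n) set" and q :: real
  assumes "open D" and "D \<noteq> UNIV" and "frontier D \<noteq> {}" and "q \<ge> 1"
  shows "(\<forall>x\<in>D. \<forall>r\<in>{0<..<1}.
            barrlund_ball D q x (R1 q r) \<subseteq> c_tilde_ball D x r \<and>
            c_tilde_ball D x r \<subseteq> barrlund_ball D q x (R2 q r)) \<and>
         ((\<lambda>r. R2 q r / R1 q r) \<longlongrightarrow> 1) (at_right 0)"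
proof (intro conjI ballI)
  have q: "0 < q" using assms by simp
  fix x and r :: real
  assume x: "x \<in> D" and r: "r \<in> {0<..<1}"
  show "barrlund_ball D q x (R1 q r) \<subseteq> c_tilde_ball D x r"
  proof
    fix y assume y: "y \<in> barrlund_ball D q x (R1 q r)"
    have "c_tilde D x y \<le> 2 powr (1 / q) * barrlund D q x y"
      using assms x q by (intro c_tilde_le_barrlund)
    also have "\<dots> < 2 powr (1 / q) * R1 q r"
      using y by (simp add: barrlund_ball_def)
    also have "\<dots> < r"
      using r by (intro R1_scaled_less) simp
    finally show "y \<in> c_tilde_ball D x r"
      using y by (simp add: barrlund_ball_def c_tilde_ball_def)
  qed
  show "c_tilde_ball D x r \<subseteq> barrlund_ball D q x (R2 q r)"
  proof
    fix y assume y: "y \<in> c_tilde_ball D x r"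
    then have c: "c_tilde D x y < r"
      by (simp add: c_tilde_ball_def)
    have "barrlund D q x y \<le> R2 q (c_tilde D x y)"
      using assms x q c r by (intro barrlund_le_c_tilde) auto
    also have "\<dots> < R2 q r"
      using c r by (intro R2_strict_mono) auto
    finally show "y \<in> barrlund_ball D q x (R2 q r)"
      using y by (simp add: barrlund_ball_def c_tilde_ball_def)
  qed
next
  have "((\<lambda>r::real. (1 + r) / (1 - r)) \<longlongrightarrow> (1 + 0) / (1 - 0)) (at_right 0)"
    by (intro tendsto_intros) auto
  \<comment> \<open>The closed form holds for \<open>r > 0\<close>, hence eventually along
    \<open>at_right 0\<close>, which suffices to transfer the limit.\<close>
  moreover have "\<forall>\<^sub>F r in at_right 0. (1 + r) / (1 - r) = R2 q r / R1 q r"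
    using eventually_at_right_less[of "0::real"] by eventually_elim (simp add: R2_div_R1)
  ultimately show "((\<lambda>r. R2 q r / R1 q r) \<longlongrightarrow> 1) (at_right 0)"
    by (simp add: tendsto_cong)
qed

end
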